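(* For every $n\ge 1$, $\mathsf{tJ}(\mathsf{lim}^{[n]})\equiv_{\mathrm W}\mathsf{T}(\mathsf{lim}^{[n]})$.
   Context: A problem is a partial multi-valued function $f:\subseteq\mathbb{N}^{\mathbb{N}}\rightrightarrows\mathbb{N}^{\mathbb{N}}$, with $\mathrm{dom}(f)=\{p: f(p)\ne\emptyset\}$. $f\le_{\mathrm W} g$ means there are partial computable functionals $\Phi:\subseteq\mathbb{N}^{\mathbb{N}}\to\mathbb{N}^{\mathbb{N}}$ and $\Psi:\subseteq\mathbb{N}^{\mathbb{N}}\times\mathbb{N}^{\mathbb{N}}\to\mathbb{N}^{\mathbb{N}}$ such that for every $p\in\mathrm{dom}(f)$: $\Phi(p)\in\mathrm{dom}(g)$ and $\Psi(p,q)\in f(p)$ for every $q\in g(\Phi(p))$. $f\equiv_{\mathrm W} g$ means $f\le_{\mathrm W} g$ and $g\le_{\mathrm W} f$. Finite products of copies of $\mathbb{N}$ and $\mathbb{N}^{\mathbb{N}}$ are identified with $\mathbb{N}^{\mathbb{N}}$ via standard computable codings, and a sequence $(x_i)_{i\in\mathbb{N}}$ in $\mathbb{N}^{\mathbb{N}}$ is coded by $x$ with $x(\langle i,j\rangle)=x_i(j)$. $(\Phi_e)_{e\in\mathbb{N}}$ is a fixed standard computable enumeration of the partial computable functionals on $\mathbb{N}^{\mathbb{N}}$; $\Phi_i(p,q)$ means $\Phi_i$ applied to the pair $(p,q)$; $\downarrow$ means defined. Tot-jump: for $e,i\in\mathbb{N}$, $p\in\mathbb{N}^{\mathbb{N}}$,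 $\mathsf{tJ}(f)(e,i,p)=\{\Phi_i(p,q): q\in f(\Phi_e(p))\}$ if $\Phi_e(p)\in\mathrm{dom}(f)$ and $\Phi_i(p,q)\downarrow$ for all $q\in f(\Phi_e(p))$; otherwise $\mathsf{tJ}(f)(e,i,p)=\mathbb{N}^{\mathbb{N}}$. Totalization: $\mathsf{T}f(x)=f(x)$ if $x\in\mathrm{dom}(f)$ and $\mathsf{T}f(x)=\mathbb{N}^{\mathbb{N}}$ otherwise. $\mathsf{lim}$ is the problem mapping (the code of) a convergent sequence in $\mathbb{N}^{\mathbb{N}}$ to its limit. Compositional product: let $(\Gamma_p)_{p\in\mathbb{N}^{\mathbb{N}}}$ be an effective enumeration of all partial continuous functionals on $\mathbb{N}^{\mathbb{N}}$ with $G_\delta$ domain. Then $f*g$ has domain $\{(p,x): x\in\mathrm{dom}(g)\text{ and }(\forall q\in g(x))\,\Gamma_p(q)\in\mathrm{dom}(f)\}$, and the solutions to $(p,x)$ are the pairs $(y,w)$ with $w\in g(x)$ and $y\in f(\Gamma_p(w))$. $f^{[n]}$ is the $n$-fold compositional product of $f$ with itself: $f^{[1]}=f$ and $f^{[n+1]}=f*f^{[n]}$. *)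

theory Defs
  imports "HOL-Analysis.Function_Topology" "HOL-Library.Nat_Bijection"
begin

type_synonym baire = "nat \<Rightarrow> nat"

section \<open>Partial computable functionals on Baire space\<close>

text \<open>
  Programs for the unary partial recursive functions relative to an oracle \<open>p\<close>. Functions of
  several arguments are unary functions on tuples coded by \<^const>\<open>prod_encode\<close>.
\<close>

datatype prog =
    Zero | Succ | Left | Right | Oracle
  | Pairing prog prog | Compose prog prog | PrimRec prog prog | Minimise prog

primrec run :: "baire \<Rightarrow> prog \<Rightarrow> nat \<Rightarrow> nat option" where
  "run p Zero n = Some 0"
| "run p Succ n = Some (Suc n)"
| "run p Left n = Some (fst (prod_decode n))"
| "run p Right n = Some (snd (prod_decode n))"
| "run p Oracle n = Some (p n)"
| "run p (Pairing c d) n =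
     Option.bind (run p c n) (\<lambda>a. Option.bind (run p d n) (\<lambda>b. Some (prod_encode (a, b))))"
| "run p (Compose c d) n = Option.bind (run p d n) (run p c)"
| "run p (PrimRec c d) n =
     (let (a, m) = prod_decode n in
      rec_nat (run p c a)
        (\<lambda>k r. Option.bind r (\<lambda>v. run p d (prod_encode (a, prod_encode (k, v))))) m)"
| "run p (Minimise c) n =
     (let halts_at = (\<lambda>m. run p c (prod_encode (n, m)) = Some 0 \<and>
                          (\<forall>k<m. \<exists>v. run p c (prod_encode (n, k)) = Some (Suc v)))
      in if \<exists>m. halts_at m then Some (LEAST m. halts_at m) else None)"

text \<open>An explicit computable bijective numbering of programs.\<close>

primrec prog_encode :: "prog \<Rightarrow> nat" where
  "prog_encode Zero = 0"
| "prog_encode Succ = 1"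
| "prog_encode Left = 2"
| "prog_encode Right = 3"
| "prog_encode Oracle = 4"
| "prog_encode (Pairing c d) = 5 + 4 * prod_encode (prog_encode c, prog_encode d)"
| "prog_encode (Compose c d) = 6 + 4 * prod_encode (prog_encode c, prog_encode d)"
| "prog_encode (PrimRec c d) = 7 + 4 * prod_encode (prog_encode c, prog_encode d)"
| "prog_encode (Minimise c) = 8 + 4 * prog_encode c"

lemma prod_decode_bounds: "fst (prod_decode n) \<le> n" "snd (prod_decode n) \<le> n"
  by (metis le_prod_encode_1 prod.collapse prod_decode_inverse)
     (metis le_prod_encode_2 prod.collapse prod_decode_inverse)

lemma prog_decode_less:
  assumes "n \<noteq> (0::nat)"
  shows "(n - 5) div 4 < n" "fst (prod_decode ((n - 5) div 4)) < n"
    "snd (prod_decode ((n - 5) div 4)) < n"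
proof -
  show *: "(n - 5) div 4 < n" using assms by simp
  show "fst (prod_decode ((n - 5) div 4)) < n" "snd (prod_decode ((n - 5) div 4)) < n"
    using prod_decode_bounds[of "(n - 5) div 4"] * by linarith+
qed

function prog_decode :: "nat \<Rightarrow> prog" where
  "prog_decode n =
    (if n = 0 then Zero else if n = 1 then Succ else if n = 2 then Left
     else if n = 3 then Right else if n = 4 then Oracle
     else let m = (n - 5) div 4; t = (n - 5) mod 4;
              a = fst (prod_decode m); b = snd (prod_decode m) in
       if t = 0 then Pairing (prog_decode a) (prog_decode b)
       else if t = 1 then Compose (prog_decode a) (prog_decode b)
       else if t = 2 then PrimRec (prog_decode a) (prog_decode b)
       else Minimise (prog_decode m))"
  by pat_completeness auto
termination
  by (relation "measure id") (auto simp: prog_decode_less)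

declare prog_decode.simps [simp del]

lemma prog_decode_step:
  assumes "t < 4"
  shows "prog_decode (5 + t + 4 * m) =
     (let a = fst (prod_decode m); b = snd (prod_decode m) in
       if t = 0 then Pairing (prog_decode a) (prog_decode b)
       else if t = 1 then Compose (prog_decode a) (prog_decode b)
       else if t = 2 then PrimRec (prog_decode a) (prog_decode b)
       else Minimise (prog_decode m))"
proof -
  have "(5 + t + 4 * m - 5) div 4 = m" "(5 + t + 4 * m - 5) mod 4 = t"
    using assms by auto
  then show ?thesis
    by (subst prog_decode.simps) (simp only: Let_def, simp)
qed

lemma prog_decode_encode [simp]: "prog_decode (prog_encode c) = c"
proof (induction c)
  case (Pairing c d)
  then show ?case
    using prog_decode_step[of 0 "prod_encode (prog_encode c, prog_encode d)"] by simp
next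
  case (Compose c d)
  then show ?case
    using prog_decode_step[of 1 "prod_encode (prog_encode c, prog_encode d)"] by simp
next
  case (PrimRec c d)
  then show ?case
    using prog_decode_step[of 2 "prod_encode (prog_encode c, prog_encode d)"] by simp
next
  case (Minimise c)
  then show ?case
    using prog_decode_step[of 3 "prog_encode c"] by simp
qed (simp_all add: prog_decode.simps)

lemma prog_encode_decode [simp]: "prog_encode (prog_decode n) = n"
proof (induction n rule: less_induct)
  case (less n)
  show ?case
  proof (cases "n < 5")
    case True
    then have "n = 0 \<or> n = 1 \<or> n = 2 \<or> n = 3 \<or> n = 4" by arith
    then show ?thesis by (auto simp: prog_decode.simps)
  next
    case False
    define m t where "m = (n - 5) div 4" and "t = (n - 5) mod 4"
    have n: "n = 5 + t + 4 * m" and t: "t = 0 \<or> t = 1 \<or> t = 2 \<or> t = 3"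
      using False by (auto simp: m_def t_def)
    then have m: "m < n" by simp
    obtain a b where ab: "prod_decode m = (a, b)" by fastforce
    then have m_eq: "prod_encode (a, b) = m" by (metis prod_decode_inverse)
    have "a < n" "b < n" using prod_decode_bounds[of m] ab m by auto
    then have IH: "prog_encode (prog_decode a) = a" "prog_encode (prog_decode b) = b"
        "prog_encode (prog_decode m) = m"
      using less m by auto
    have "prog_decode n =
       (if t = 0 then Pairing (prog_decode a) (prog_decode b)
        else if t = 1 then Compose (prog_decode a) (prog_decode b)
        else if t = 2 then PrimRec (prog_decode a) (prog_decode b)
        else Minimise (prog_decode m))"
      using False by (subst prog_decode.simps) (simp add: m_def[symmetric] t_def[symmetric] ab Let_def)
    with t IH m_eq n show ?thesis by auto
  qed
qed

text \<open>
  The enumeration of the partial computable functionals. A functional is defined at \<open>p\<close> iff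
  the program computes a total function from the oracle \<open>p\<close>.
\<close>

definition Phi :: "nat \<Rightarrow> baire \<Rightarrow> baire option" where
  "Phi e p =
    (if \<forall>k. run p (prog_decode e) k \<noteq> None
     then Some (\<lambda>k. the (run p (prog_decode e) k)) else None)"

definition computable_functional :: "(baire \<Rightarrow> baire option) \<Rightarrow> bool" where
  "computable_functional F \<longleftrightarrow> (\<exists>e. F = Phi e)"

section \<open>Codings\<close>

definition pair :: "baire \<Rightarrow> baire \<Rightarrow> baire" where
  "pair p q = (\<lambda>n. if even n then p (n div 2) else q (n div 2))"

definition pfst :: "baire \<Rightarrow> baire" where
  "pfst x = (\<lambda>n. x (2 * n))"

definition psnd :: "baire \<Rightarrow> baire" where
  "psnd x = (\<lambda>n. x (2 * n + 1))"

lemma pair_simps [simp]: "pfst (pair p q) = p" "psnd (pair p q) = q" "pair (pfst x) (psnd x) = x"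
  by (auto simp: pair_def pfst_def psnd_def fun_eq_iff elim: oddE)

text \<open>The coding \<open>\<nat> \<times> \<nat>\<^sup>\<nat> \<cong> \<nat>\<^sup>\<nat>\<close> prepends the number; its inverse is \<open>x \<mapsto> (x 0, tail x)\<close>.\<close>

definition prepend :: "nat \<Rightarrow> baire \<Rightarrow> baire" where
  "prepend a p = case_nat a p"

definition tail :: "baire \<Rightarrow> baire" where
  "tail x = (\<lambda>n. x (Suc n))"

lemma prepend_simps [simp]: "prepend a p 0 = a" "tail (prepend a p) = p"
    "prepend (x 0) (tail x) = x"
  by (auto simp: prepend_def tail_def fun_eq_iff split: nat.split)

definition seq_of :: "baire \<Rightarrow> nat \<Rightarrow> baire" where
  "seq_of x i = (\<lambda>j. x (prod_encode (i, j)))"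

section \<open>Problems and Weihrauch reducibility\<close>

type_synonym problem = "baire \<Rightarrow> baire set"

definition pdom :: "problem \<Rightarrow> baire set" where
  "pdom f = {p. f p \<noteq> {}}"

definition weihrauch_le :: "problem \<Rightarrow> problem \<Rightarrow> bool"  (infix \<open>\<le>\<^sub>W\<close> 50) where
  "f \<le>\<^sub>W g \<longleftrightarrow>
    (\<exists>F G. computable_functional F \<and> computable_functional G \<and>
      (\<forall>p\<in>pdom f. \<exists>x. F p = Some x \<and> x \<in> pdom g \<and>
        (\<forall>q\<in>g x. \<exists>y. G (pair p q) = Some y \<and> y \<in> f p)))"

definition weihrauch_equiv :: "problem \<Rightarrow> problem \<Rightarrow> bool"  (infix \<open>\<equiv>\<^sub>W\<close> 50) where
  "f \<equiv>\<^sub>W g \<longleftrightarrow> f \<le>\<^sub>W g \<and> g \<le>\<^sub>W f"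

definition totalization :: "problem \<Rightarrow> problem" where
  "totalization f x = (if x \<in> pdom f then f x else UNIV)"

definition tot_jump_at :: "problem \<Rightarrow> nat \<Rightarrow> nat \<Rightarrow> baire \<Rightarrow> baire set" where
  "tot_jump_at f e i p =
    (if \<exists>x. Phi e p = Some x \<and> x \<in> pdom f \<and> (\<forall>q\<in>f x. Phi i (pair p q) \<noteq> None)
     then {y. \<exists>q\<in>f (the (Phi e p)). Phi i (pair p q) = Some y}
     else UNIV)"

text \<open>The instance \<open>(e, i, p)\<close> is coded by \<open>prepend e (prepend i p)\<close>.\<close>

definition tot_jump :: "problem \<Rightarrow> problem" where
  "tot_jump f z = tot_jump_at f (z 0) (tail z 0) (tail (tail z))"

text \<open>Convergence in the product topology on \<open>\<nat>\<^sup>\<nat>\<close>, with \<open>\<nat>\<close> discrete.\<close>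

definition lim_problem :: problem where
  "lim_problem x = {y. seq_of x \<longlonglongrightarrow> y}"

section \<open>Compositional products\<close>

text \<open>
  The functionals \<open>Gamma p\<close> are the partial computable functionals with a parameter in Baire
  space: the first entry of \<open>p\<close> is a program and the rest of \<open>p\<close> is the parameter. As domains are
  the natural ones (all points at which the computation succeeds), these are the partial
  continuous functionals with a \<open>G\<^sub>\<delta>\<close> domain.
\<close>

definition Gamma :: "baire \<Rightarrow> baire \<Rightarrow> baire option" where
  "Gamma p q = Phi (p 0) (pair (tail p) q)"

definition comp_product :: "problem \<Rightarrow> problem \<Rightarrow> problem"  (infixr \<open>\<star>\<close> 70) where
  "(f \<star> g) z =
    (let p = pfst z; x = psnd z in
     if x \<in> pdom g \<and> (\<forall>q\<in>g x. \<exists>u. Gamma p q = Some u \<and> u \<in> pdom f)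
     then {pair y w |y w. w \<in> g x \<and> (\<exists>u. Gamma p w = Some u \<and> y \<in> f u)}
     else {})"

text \<open>The power is of interest for positive exponents; at \<open>0\<close> it is set to the identity.\<close>

fun comp_power :: "problem \<Rightarrow> nat \<Rightarrow> problem" where
  "comp_power f 0 = (\<lambda>x. {x})"
| "comp_power f (Suc 0) = f"
| "comp_power f (Suc (Suc n)) = f \<star> comp_power f (Suc n)"

end

theory Submission
  imports Defs
begin

text \<open>
  For every problem \<open>f\<close>, the tot-jump computes the totalization: run \<open>f\<close> on the instance itself
  and project to its answer; outside \<open>pdom f\<close> both problems accept everything.

  The converse needs a special feature of iterated limits. An instance of the tot-jump names a
  partial computation of an instance of \<open>f\<close> and a partial computation on the answer, whereas a
  reduction to the totalization must, on every input, output an instance of \<open>f\<close> and postprocess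
  any answer to it. It suffices that \<open>f\<close> absorbs partiality (\<open>absorbs_partiality\<close>): a total
  computable map produces an instance of \<open>f\<close> whose answers already contain the postprocessed
  answers, up to a fixed total computable map \<open>K\<close>, whenever the partial computations behave.
  When they do not, the tot-jump accepts everything, so totality of the maps is enough.

  A single limit absorbs partiality (\<open>lim_absorbs_partiality\<close>). At stage \<open>s\<close> one approximates the
  limit from the entries whose computation has ended within \<open>s\<close> steps, runs the postprocessing on
  this approximation for \<open>s\<close> steps, and writes a default value where no result has been found.
  A halting computation reads only finitely many oracle values, which are eventually correct, so
  the stages converge to the true result.

  Absorption is inherited by compositional products (\<open>comp_product_absorbs_partiality\<close>). In
  \<open>f \<star> g\<close> the inner instance is totalized by absorption for \<open>g\<close>. Its answer makes the instance of
  \<open>f\<close> and the final postprocessing two partial computable functionals, which absorption for \<open>f\<close>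
  turns into a total one, and its program is what the product receives as its first argument.
  Induction gives all powers of the limit.

  Step-bounded and universal evaluation rest on a stack machine whose transition function is a
  total computable functional (\<open>total_computable_step\<close>, \<open>machine_complete\<close>).
\<close>

section \<open>Total computable functionals\<close>

abbreviation cpair :: "nat \<Rightarrow> nat \<Rightarrow> nat"  (\<open>\<langle>_,/ _\<rangle>\<close>) where
  "\<langle>a, b\<rangle> \<equiv> prod_encode (a, b)"

abbreviation nfst :: "nat \<Rightarrow> nat" where
  "nfst n \<equiv> fst (prod_decode n)"

abbreviation nsnd :: "nat \<Rightarrow> nat" where
  "nsnd n \<equiv> snd (prod_decode n)"

definition computes :: "prog \<Rightarrow> baire \<Rightarrow> baire \<Rightarrow> bool" where
  "computes c p x \<longleftrightarrow> (\<forall>k. run p c k = Some (x k))"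

definition total_computable :: "(baire \<Rightarrow> baire) \<Rightarrow> bool" where
  "total_computable t \<longleftrightarrow> (\<exists>c. \<forall>p. computes c p (t p))"

lemma Phi_encode_iff: "Phi (prog_encode c) p = Some x \<longleftrightarrow> computes c p x"
  unfolding Phi_def computes_def by (auto simp: fun_eq_iff) (metis option.sel option.distinct(1))+

lemma Phi_iff: "Phi e p = Some x \<longleftrightarrow> computes (prog_decode e) p x"
  using Phi_encode_iff[of "prog_decode e"] by simp

lemma total_computable_functional:
  assumes "total_computable t"
  shows "computable_functional (\<lambda>p. Some (t p))"
proof -
  obtain c where "\<And>p. computes c p (t p)" using assms unfolding total_computable_def by blast
  then have "(\<lambda>p. Some (t p)) = Phi (prog_encode c)"
    by (auto simp: fun_eq_iff Phi_encode_iff[symmetric])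
  then show ?thesis unfolding computable_functional_def by blast
qed

text \<open>
  The closure rules below have the form of introduction rules for functions of the oracle and a
  numerical input, so that computability of a total functional follows from its defining term by
  resolution.
\<close>

named_theorems computable_intros

lemma total_computable_input [computable_intros]: "total_computable (\<lambda>p n. n)"
  unfolding total_computable_def computes_def
  by (rule exI[of _ "Pairing Left Right"]) simp

lemma total_computable_oracle [computable_intros]:
  assumes "total_computable f"
  shows "total_computable (\<lambda>p n. p (f p n))"
proof -
  obtain c where "\<And>p. computes c p (f p)" using assms unfolding total_computable_def by blast
  then show ?thesis unfolding total_computable_def computes_def
    by (intro exI[of _ "Compose Oracle c"]) simp
qed

lemma total_computable_id: "total_computable (\<lambda>p. p)"
  using total_computable_oracle[OF total_computable_input] .

lemma total_computable_Suc [computable_intros]: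
  assumes "total_computable f"
  shows "total_computable (\<lambda>p n. Suc (f p n))"
proof -
  obtain c where "\<And>p. computes c p (f p)" using assms unfolding total_computable_def by blast
  then show ?thesis unfolding total_computable_def computes_def
    by (intro exI[of _ "Compose Succ c"]) simp
qed

lemma total_computable_nfst [computable_intros]:
  assumes "total_computable f"
  shows "total_computable (\<lambda>p n. nfst (f p n))"
proof -
  obtain c where "\<And>p. computes c p (f p)" using assms unfolding total_computable_def by blast
  then show ?thesis unfolding total_computable_def computes_def
    by (intro exI[of _ "Compose Left c"]) simp
qed

lemma total_computable_nsnd [computable_intros]:
  assumes "total_computable f"
  shows "total_computable (\<lambda>p n. nsnd (f p n))"
proof -
  obtain c where "\<And>p. computes c p (f p)" using assms unfolding total_computable_def by blast
  then show ?thesis unfolding total_computable_def computes_def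
    by (intro exI[of _ "Compose Right c"]) simp
qed

lemma total_computable_cpair [computable_intros]:
  assumes "total_computable f" "total_computable g"
  shows "total_computable (\<lambda>p n. \<langle>f p n, g p n\<rangle>)"
proof -
  obtain c d where "\<And>p. computes c p (f p)" "\<And>p. computes d p (g p)"
    using assms unfolding total_computable_def by blast
  then show ?thesis unfolding total_computable_def computes_def
    by (intro exI[of _ "Pairing c d"]) simp
qed

text \<open>
  The conclusion is not a higher-order pattern, so resolution with this rule is controlled by
  instantiating \<open>f\<close>.
\<close>

lemma total_computable_apply:
  assumes "total_computable f" "total_computable g"
  shows "total_computable (\<lambda>p n. f p (g p n))"
proof -
  obtain c d where "\<And>p. computes c p (f p)" "\<And>p. computes d p (g p)"
    using assms unfolding total_computable_def by blast
  then show ?thesis unfolding total_computable_def computes_def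
    by (intro exI[of _ "Compose c d"]) simp
qed

lemma total_computable_const [computable_intros]: "total_computable (\<lambda>p n. a)"
proof (induction a)
  case 0
  show ?case unfolding total_computable_def computes_def by (rule exI[of _ Zero]) simp
next
  case (Suc a)
  then show ?case by (rule total_computable_Suc)
qed

lemma total_computable_rec [computable_intros]:
  assumes "total_computable f"
    and "total_computable (\<lambda>p n. g p (nfst n) (nfst (nsnd n)) (nsnd (nsnd n)))"
    and "total_computable m"
  shows "total_computable (\<lambda>p n. rec_nat (f p n) (\<lambda>k r. g p n k r) (m p n))"
proof -
  obtain c d where c: "\<And>p. computes c p (f p)"
    and d: "\<And>p. computes d p (\<lambda>n. g p (nfst n) (nfst (nsnd n)) (nsnd (nsnd n)))"
    using assms(1,2) unfolding total_computable_def by blast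
  have rec: "rec_nat (run p c a) (\<lambda>k r. Option.bind r (\<lambda>v. run p d \<langle>a, \<langle>k, v\<rangle>\<rangle>)) j
      = Some (rec_nat (f p a) (\<lambda>k r. g p a k r) j)" for p a j
    using c d by (induction j) (simp_all add: computes_def)
  have "computes (PrimRec c d) p
      (\<lambda>n. rec_nat (f p (nfst n)) (\<lambda>k r. g p (nfst n) k r) (nsnd n))" for p
    unfolding computes_def by (simp add: rec split: prod.split)
  then have "total_computable (\<lambda>p n. rec_nat (f p (nfst n)) (\<lambda>k r. g p (nfst n) k r) (nsnd n))"
    unfolding total_computable_def by blast
  from total_computable_apply[OF this
      total_computable_cpair[OF total_computable_input assms(3)]]
  show ?thesis by simp
qed

lemma total_computable_pred [computable_intros]:
  assumes "total_computable f"
  shows "total_computable (\<lambda>p n. f p n - 1)"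
proof -
  have "rec_nat 0 (\<lambda>k r. k) j = j - 1" for j :: nat by (cases j) simp_all
  moreover have "total_computable (\<lambda>p n. rec_nat 0 (\<lambda>k r. k) (f p n))"
    by (intro computable_intros assms)
  ultimately show ?thesis by simp
qed

lemma total_computable_diff [computable_intros]:
  assumes "total_computable f" "total_computable g"
  shows "total_computable (\<lambda>p n. f p n - g p n)"
proof -
  have "rec_nat a (\<lambda>k r. r - 1) j = a - j" for a j :: nat by (induction j) simp_all
  moreover have "total_computable (\<lambda>p n. rec_nat (f p n) (\<lambda>k r. r - 1) (g p n))"
    by (intro computable_intros assms)
  ultimately show ?thesis by simp
qed

text \<open>Two numbers are equal iff both truncated differences vanish.\<close>

lemma total_computable_if_eq [computable_intros]:
  assumes "total_computable f" "total_computable g" "total_computable x" "total_computable y"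
  shows "total_computable (\<lambda>p n. if f p n = g p n then x p n else y p n)"
proof -
  have "rec_nat (rec_nat x (\<lambda>k r. y) (j - i)) (\<lambda>k r. y) (i - j) = (if i = j then x else y)"
    for i j x y :: nat
    by (cases "i - j"; cases "j - i") auto
  moreover have "total_computable (\<lambda>p n.
      rec_nat (rec_nat (x p n) (\<lambda>k r. y p n) (g p n - f p n)) (\<lambda>k r. y p n) (f p n - g p n))"
    by (intro computable_intros total_computable_apply[OF assms(4)] assms)
  ultimately show ?thesis by simp
qed

lemma total_computable_mod [computable_intros]:
  assumes "total_computable f"
  shows "total_computable (\<lambda>p n. f p n mod d)"
proof (cases "d = 0")
  case False
  then have "rec_nat 0 (\<lambda>k r. if Suc r = d then 0 else Suc r) j = j mod d" for j
    by (induction j) (simp_all add: mod_Suc)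
  moreover have "total_computable
      (\<lambda>p n. rec_nat 0 (\<lambda>k r. if Suc r = d then 0 else Suc r) (f p n))"
    by (intro computable_intros assms)
  ultimately show ?thesis by simp
qed (simp add: assms)

lemma total_computable_div [computable_intros]:
  assumes "total_computable f"
  shows "total_computable (\<lambda>p n. f p n div d)"
proof -
  have "rec_nat 0 (\<lambda>k r. if Suc k mod d = 0 then Suc r else r) j = j div d" for j
    by (induction j) (simp_all add: div_Suc)
  moreover have "total_computable
      (\<lambda>p n. rec_nat 0 (\<lambda>k r. if Suc k mod d = 0 then Suc r else r) (f p n))"
    by (intro computable_intros assms)
  ultimately show ?thesis by simp
qed

lemma total_computable_pair [computable_intros]:
  assumes "total_computable s" "total_computable t"
  shows "total_computable (\<lambda>p. pair (s p) (t p))"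
  unfolding pair_def even_iff_mod_2_eq_zero
  by (intro computable_intros total_computable_apply[OF assms(1)]
      total_computable_apply[OF assms(2)])

lemma total_computable_double:
  "total_computable (\<lambda>p n. 2 * n)"
proof -
  have "rec_nat 0 (\<lambda>k r. Suc (Suc r)) j = 2 * j" for j :: nat by (induction j) simp_all
  moreover have "total_computable (\<lambda>p n. rec_nat 0 (\<lambda>k r. Suc (Suc r)) n)"
    by (intro computable_intros)
  ultimately show ?thesis by simp
qed

lemma total_computable_pfst [computable_intros]:
  assumes "total_computable t"
  shows "total_computable (\<lambda>p. pfst (t p))"
  unfolding pfst_def by (rule total_computable_apply[OF assms total_computable_double])

lemma total_computable_psnd [computable_intros]:
  assumes "total_computable t"
  shows "total_computable (\<lambda>p. psnd (t p))"
  unfolding psnd_def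
  by (rule total_computable_apply[OF assms])
     (use total_computable_Suc[OF total_computable_double] in simp)

lemma total_computable_tail [computable_intros]:
  assumes "total_computable t"
  shows "total_computable (\<lambda>p. tail (t p))"
  unfolding tail_def by (rule total_computable_apply[OF assms]) (intro computable_intros)

lemma total_computable_prepend [computable_intros]:
  assumes "total_computable (\<lambda>p n. f p)" "total_computable t"
  shows "total_computable (\<lambda>p. prepend (f p) (t p))"
proof -
  have "prepend a x = (\<lambda>n. if n = 0 then a else x (n - 1))" for a x
    by (auto simp: prepend_def fun_eq_iff split: nat.split)
  moreover have "total_computable (\<lambda>p n. if n = 0 then f p else t p (n - 1))"
    by (intro computable_intros assms total_computable_apply[OF assms(2)])
  ultimately show ?thesis by simp
qed

section \<open>Substitution for the oracle\<close>

text \<open>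
  Oracle calls are replaced by a program \<open>b\<close> that receives a numerical parameter along with the
  query, so that one program can be run with a whole sequence of oracles. The parameter is threaded
  through the computation as the left component of the input; recursion and minimisation append
  their counters on the right, whence the reassociations.
\<close>

primrec subst_oracle :: "prog \<Rightarrow> prog \<Rightarrow> prog" where
  "subst_oracle b Zero = Zero"
| "subst_oracle b Succ = Compose Succ Right"
| "subst_oracle b Left = Compose Left Right"
| "subst_oracle b Right = Compose Right Right"
| "subst_oracle b Oracle = b"
| "subst_oracle b (Pairing c d) = Pairing (subst_oracle b c) (subst_oracle b d)"
| "subst_oracle b (Compose c d) = Compose (subst_oracle b c) (Pairing Left (subst_oracle b d))"
| "subst_oracle b (PrimRec c d) =
     Compose
       (PrimRec (subst_oracle b c)
         (Compose (subst_oracle b d)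
           (Pairing (Compose Left Left) (Pairing (Compose Right Left) Right))))
       (Pairing (Pairing Left (Compose Left Right)) (Compose Right Right))"
| "subst_oracle b (Minimise c) =
     Minimise (Compose (subst_oracle b c)
       (Pairing (Compose Left Left) (Pairing (Compose Right Left) Right)))"

lemma run_subst_oracle:
  assumes "\<And>k. run p b \<langle>a, k\<rangle> = Some (x k)"
  shows "run p (subst_oracle b c) \<langle>a, n\<rangle> = run x c n"
proof (induction c arbitrary: n)
  case (Compose c d)
  then show ?case by (cases "run x d n") simp_all
next
  case (PrimRec c d)
  obtain i j where n: "n = \<langle>i, j\<rangle>" by (metis prod.collapse prod_decode_inverse)
  have "rec_nat (run x c i) (\<lambda>k r. Option.bind r
          (\<lambda>v. run p (subst_oracle b d) \<langle>a, \<langle>i, \<langle>k, v\<rangle>\<rangle>\<rangle>)) j =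
        rec_nat (run x c i) (\<lambda>k r. Option.bind r (\<lambda>v. run x d \<langle>i, \<langle>k, v\<rangle>\<rangle>)) j"
    using PrimRec by simp
  then show ?case using PrimRec by (simp add: n)
qed (use assms in simp_all)

lemma total_computable_oracle_param:
  assumes "total_computable f" "total_computable r" "total_computable i" "total_computable j"
  shows "total_computable (\<lambda>p n. f (\<lambda>m. r p \<langle>i p n, m\<rangle>) (j p n))"
proof -
  obtain c b where c: "\<And>p. computes c p (f p)" and b: "\<And>p. computes b p (r p)"
    using assms(1,2) unfolding total_computable_def by blast
  have "run p (subst_oracle b c) n = Some (f (\<lambda>m. r p \<langle>nfst n, m\<rangle>) (nsnd n))" for p n
    using run_subst_oracle[of p b "nfst n" "\<lambda>m. r p \<langle>nfst n, m\<rangle>" c "nsnd n"] b c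
    by (simp add: computes_def)
  then have "total_computable (\<lambda>p n. f (\<lambda>m. r p \<langle>nfst n, m\<rangle>) (nsnd n))"
    unfolding total_computable_def computes_def by blast
  from total_computable_apply[OF this total_computable_cpair[OF assms(3,4)]]
  show ?thesis by simp
qed

text \<open>
  Composition of functionals, where the inner one may be partial: the composite need only be
  correct at points where the inner one is defined. The parameter of the substitution is \<open>0\<close>.
\<close>

lemma compose_programs:
  "\<exists>d. \<forall>p x n. computes b p x \<longrightarrow> run p d n = run x c n"
proof (intro exI allI impI)
  fix p x n
  assume "computes b p x"
  then show "run p (Compose (subst_oracle (Compose b Right) c) (Pairing Zero (Pairing Left Right))) n
      = run x c n"
    using run_subst_oracle[of p "Compose b Right" 0 x c n] by (simp add: computes_def)
qed

lemma precompose_total: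
  assumes "total_computable t"
  shows "\<exists>d. \<forall>p n. run p d n = run (t p) c n"
proof -
  obtain b where "\<forall>p. computes b p (t p)" using assms unfolding total_computable_def by blast
  with compose_programs[of b c] show ?thesis by blast
qed

lemma total_computable_compose:
  assumes "total_computable s" "total_computable t"
  shows "total_computable (\<lambda>p. s (t p))"
  using total_computable_oracle_param[OF assms(1), of "\<lambda>p n. t p (nsnd n)" "\<lambda>p n. 0" "\<lambda>p n. n"]
  by (simp add: computable_intros total_computable_apply[OF assms(2)])

section \<open>A stack machine for relative computations\<close>

text \<open>
  An interpreter by recursion on the numbers of programs would not be primitive recursive in an
  obvious way, because nested calls depend on intermediate results. Pending work is therefore kept
  on a stack, and a single transition needs only case distinctions and projections.

  A stack is \<open>0\<close> or \<open>Suc \<langle>tag, \<langle>data, rest\<rangle>\<rangle>\<close>. A state \<open>\<langle>Suc e, \<langle>n, k\<rangle>\<rangle>\<close> is about to evaluate the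
  program with number \<open>e\<close> at \<open>n\<close>; a state \<open>\<langle>0, \<langle>v, k\<rangle>\<rangle>\<close> hands the value \<open>v\<close> to the topmost frame of
  the stack \<open>k\<close>. The frames wait for
  \<^item> the first component of a pairing (tag 0, data: program of the second component and input),
  \<^item> the second component (tag 1, data: value of the first),
  \<^item> the inner value of a composition (tag 2, data: outer program),
  \<^item> a value of a recursion (tag 3, data: step program, parameter, index, number of steps left),
  \<^item> a test of a minimisation (tag 4, data: program, input, candidate).
\<close>

abbreviation push :: "nat \<Rightarrow> nat \<Rightarrow> nat \<Rightarrow> nat" where
  "push tag d k \<equiv> Suc \<langle>tag, \<langle>d, k\<rangle>\<rangle>"

abbreviation evaluating :: "nat \<Rightarrow> nat \<Rightarrow> nat \<Rightarrow> nat" where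
  "evaluating e n k \<equiv> \<langle>Suc e, \<langle>n, k\<rangle>\<rangle>"

abbreviation returning :: "nat \<Rightarrow> nat \<Rightarrow> nat" where
  "returning v k \<equiv> \<langle>0, \<langle>v, k\<rangle>\<rangle>"

text \<open>The numerical case distinctions follow \<^const>\<open>prog_encode\<close>.\<close>

definition start :: "baire \<Rightarrow> nat \<Rightarrow> nat \<Rightarrow> nat \<Rightarrow> nat" where
  "start q e n k =
    (if e = 0 then returning 0 k
     else if e = 1 then returning (Suc n) k
     else if e = 2 then returning (nfst n) k
     else if e = 3 then returning (nsnd n) k
     else if e = 4 then returning (q n) k
     else if (e - 5) mod 4 = 0 then
       evaluating (nfst ((e - 5) div 4)) n (push 0 \<langle>nsnd ((e - 5) div 4), n\<rangle> k)
     else if (e - 5) mod 4 = 1 then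
       evaluating (nsnd ((e - 5) div 4)) n (push 2 (nfst ((e - 5) div 4)) k)
     else if (e - 5) mod 4 = 2 then
       evaluating (nfst ((e - 5) div 4)) (nfst n)
         (push 3 \<langle>nsnd ((e - 5) div 4), \<langle>nfst n, \<langle>0, nsnd n\<rangle>\<rangle>\<rangle> k)
     else evaluating ((e - 5) div 4) \<langle>n, 0\<rangle> (push 4 \<langle>(e - 5) div 4, \<langle>n, 0\<rangle>\<rangle> k))"

definition resume :: "nat \<Rightarrow> nat \<Rightarrow> nat \<Rightarrow> nat \<Rightarrow> nat" where
  "resume tag d v k =
    (if tag = 0 then evaluating (nfst d) (nsnd d) (push 1 v k)
     else if tag = 1 then returning \<langle>d, v\<rangle> k
     else if tag = 2 then evaluating d v k
     else if tag = 3 then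
       (if nsnd (nsnd (nsnd d)) = 0 then returning v k
        else evaluating (nfst d) \<langle>nfst (nsnd d), \<langle>nfst (nsnd (nsnd d)), v\<rangle>\<rangle>
          (push 3 \<langle>nfst d, \<langle>nfst (nsnd d),
             \<langle>Suc (nfst (nsnd (nsnd d))), nsnd (nsnd (nsnd d)) - 1\<rangle>\<rangle>\<rangle> k))
     else
       (if v = 0 then returning (nsnd (nsnd d)) k
        else evaluating (nfst d) \<langle>nfst (nsnd d), Suc (nsnd (nsnd d))\<rangle>
          (push 4 \<langle>nfst d, \<langle>nfst (nsnd d), Suc (nsnd (nsnd d))\<rangle>\<rangle> k)))"

definition step :: "baire \<Rightarrow> nat \<Rightarrow> nat" where
  "step q s =
    (if nfst s = 0 then
       (if nsnd (nsnd s) = 0 then s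
        else resume (nfst (nsnd (nsnd s) - 1)) (nfst (nsnd (nsnd (nsnd s) - 1)))
          (nfst (nsnd s)) (nsnd (nsnd (nsnd (nsnd s) - 1))))
     else start q (nfst s - 1) (nfst (nsnd s)) (nsnd (nsnd s)))"

lemma step_simps:
  "step q (evaluating e n k) = start q e n k"
  "step q (returning v (push tag d k)) = resume tag d v k"
  by (simp_all add: step_def)

lemma total_computable_start [computable_intros]:
  assumes "total_computable e" "total_computable a" "total_computable k"
  shows "total_computable (\<lambda>p n. start p (e p n) (a p n) (k p n))"
  unfolding start_def by (intro computable_intros assms)

lemma total_computable_resume [computable_intros]:
  assumes "total_computable i" "total_computable d" "total_computable a" "total_computable k"
  shows "total_computable (\<lambda>p n. resume (i p n) (d p n) (a p n) (k p n))"
  unfolding resume_def by (intro computable_intros assms)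

lemma total_computable_step [computable_intros]:
  assumes "total_computable s"
  shows "total_computable (\<lambda>p n. step p (s p n))"
  unfolding step_def by (intro computable_intros assms)

definition state_after :: "baire \<Rightarrow> nat \<Rightarrow> nat \<Rightarrow> nat" where
  "state_after q s t = rec_nat s (\<lambda>_. step q) t"

lemma state_after_add: "state_after q s (t + u) = state_after q (state_after q s t) u"
  by (induction u) (simp_all add: state_after_def)

definition reaches :: "baire \<Rightarrow> nat \<Rightarrow> nat \<Rightarrow> bool" where
  "reaches q s s' \<longleftrightarrow> (\<exists>t. state_after q s t = s')"

lemma reaches_trans [trans]: "reaches q s s' \<Longrightarrow> reaches q s' s'' \<Longrightarrow> reaches q s s''"
  unfolding reaches_def by (metis state_after_add)

lemma reaches_step: "reaches q (step q s) s' \<Longrightarrow> reaches q s s'"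
proof -
  have "reaches q s (step q s)"
    unfolding reaches_def by (rule exI[of _ 1]) (simp add: state_after_def)
  then show "reaches q (step q s) s' \<Longrightarrow> reaches q s s'" by (rule reaches_trans)
qed

lemma reaches_refl [simp]: "reaches q s s"
  unfolding reaches_def by (rule exI[of _ 0]) (simp add: state_after_def)

lemma reaches_evaluating: "reaches q (start q e n k) s' \<Longrightarrow> reaches q (evaluating e n k) s'"
  by (rule reaches_step) (simp add: step_simps)

lemma reaches_returning:
  "reaches q (resume tag d v k) s' \<Longrightarrow> reaches q (returning v (push tag d k)) s'"
  by (rule reaches_step) (simp add: step_simps)

lemma start_simps:
  "start q (5 + 4 * \<langle>a, b\<rangle>) n k = evaluating a n (push 0 \<langle>b, n\<rangle> k)"
  "start q (6 + 4 * \<langle>a, b\<rangle>) n k = evaluating b n (push 2 a k)"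
  "start q (7 + 4 * \<langle>a, b\<rangle>) n k =
     evaluating a (nfst n) (push 3 \<langle>b, \<langle>nfst n, \<langle>0, nsnd n\<rangle>\<rangle>\<rangle> k)"
  "start q (8 + 4 * a) n k = evaluating a \<langle>n, 0\<rangle> (push 4 \<langle>a, \<langle>n, 0\<rangle>\<rangle> k)"
proof -
  have number: "(5 + t + 4 * m - 5) mod 4 = t" "(5 + t + 4 * m - 5) div 4 = m" if "t < 4" for t m :: nat
    using that by auto
  note mod_div = number[of 0, simplified] number[of 1, simplified] number[of 2, simplified]
    number[of 3, simplified]
  show "start q (5 + 4 * \<langle>a, b\<rangle>) n k = evaluating a n (push 0 \<langle>b, n\<rangle> k)"
    by (simp add: start_def mod_div)
  show "start q (6 + 4 * \<langle>a, b\<rangle>) n k = evaluating b n (push 2 a k)"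
    by (simp add: start_def mod_div)
  show "start q (7 + 4 * \<langle>a, b\<rangle>) n k =
     evaluating a (nfst n) (push 3 \<langle>b, \<langle>nfst n, \<langle>0, nsnd n\<rangle>\<rangle>\<rangle> k)"
    by (simp add: start_def mod_div)
  show "start q (8 + 4 * a) n k = evaluating a \<langle>n, 0\<rangle> (push 4 \<langle>a, \<langle>n, 0\<rangle>\<rangle> k)"
    by (simp add: start_def mod_div)
qed

text \<open>
  Quantifying over the stack \<open>k\<close> makes the induction on programs work: a subcomputation leaves the
  frames beneath it untouched.
\<close>

lemma machine_complete:
  assumes "run q c n = Some v"
  shows "reaches q (evaluating (prog_encode c) n k) (returning v k)"
  using assms
proof (induction c arbitrary: n v k)
  case (Pairing c d)
  from Pairing.prems obtain a b
    where a: "run q c n = Some a" and b: "run q d n = Some b" and v: "v = \<langle>a, b\<rangle>"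
    by (auto simp: bind_eq_Some_conv)
  let ?k = "push 0 \<langle>prog_encode d, n\<rangle> k"
  have "reaches q (returning b (push 1 a k)) (returning v k)"
    by (intro reaches_returning) (simp add: resume_def v)
  with Pairing.IH(2)[OF b] have "reaches q (evaluating (prog_encode d) n (push 1 a k)) (returning v k)"
    by (rule reaches_trans)
  then have "reaches q (returning a ?k) (returning v k)"
    by (intro reaches_returning) (simp add: resume_def)
  with Pairing.IH(1)[OF a] have "reaches q (evaluating (prog_encode c) n ?k) (returning v k)"
    by (rule reaches_trans)
  then show ?case by (intro reaches_evaluating) (simp add: start_simps)
next
  case (Compose c d)
  from Compose.prems obtain a where a: "run q d n = Some a" and v: "run q c a = Some v"
    by (auto simp: bind_eq_Some_conv)
  let ?k = "push 2 (prog_encode c) k"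
  have "reaches q (returning a ?k) (returning v k)"
    by (intro reaches_returning) (use Compose.IH(1)[OF v] in \<open>simp add: resume_def\<close>)
  with Compose.IH(2)[OF a] have "reaches q (evaluating (prog_encode d) n ?k) (returning v k)"
    by (rule reaches_trans)
  then show ?case by (intro reaches_evaluating) (simp add: start_simps)
next
  case (PrimRec c d)
  obtain a m where n: "n = \<langle>a, m\<rangle>" by (metis prod.collapse prod_decode_inverse)
  define R where "R = rec_nat (run q c a) (\<lambda>k r. Option.bind r (\<lambda>v. run q d \<langle>a, \<langle>k, v\<rangle>\<rangle>))"
  define K where "K i j = push 3 \<langle>prog_encode d, \<langle>a, \<langle>i, j\<rangle>\<rangle>\<rangle> k" for i j
  have Rm: "R m = Some v" using PrimRec.prems by (simp add: n R_def)
  have loop: "reaches q (returning u (K i j)) (returning v k)"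
    if "R i = Some u" "R (i + j) = Some v" for i j u
    using that
  proof (induction j arbitrary: i u)
    case 0
    then show ?case unfolding K_def by (intro reaches_returning) (simp add: resume_def)
  next
    case (Suc j)
    \<comment> \<open>An undefined intermediate value would make the final one undefined.\<close>
    have "R (Suc i) \<noteq> None"
    proof
      assume "R (Suc i) = None"
      then have "R (Suc i + j) = None" by (induction j) (simp_all add: R_def)
      then show False using Suc.prems by simp
    qed
    then obtain w where w: "R (Suc i) = Some w" by blast
    then have "run q d \<langle>a, \<langle>i, u\<rangle>\<rangle> = Some w" using Suc.prems(1) by (simp add: R_def)
    then have "reaches q (evaluating (prog_encode d) \<langle>a, \<langle>i, u\<rangle>\<rangle> (K (Suc i) j))
        (returning w (K (Suc i) j))"
      by (rule PrimRec.IH(2))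
    also have "reaches q (returning w (K (Suc i) j)) (returning v k)"
      using Suc.IH w Suc.prems(2) by simp
    finally show ?case
      unfolding K_def by (intro reaches_returning) (simp add: resume_def)
  qed
  have "R 0 \<noteq> None"
  proof
    assume "R 0 = None"
    then have "R m = None" by (induction m) (simp_all add: R_def)
    with Rm show False by simp
  qed
  then obtain u where u: "R 0 = Some u" by blast
  then have "run q c a = Some u" by (simp add: R_def)
  then have "reaches q (evaluating (prog_encode c) a (K 0 m)) (returning u (K 0 m))"
    by (rule PrimRec.IH(1))
  also have "reaches q (returning u (K 0 m)) (returning v k)"
    using loop[OF u] Rm by simp
  finally show ?case
    unfolding K_def by (intro reaches_evaluating) (simp add: start_simps n)
next
  case (Minimise c)
  define halts where "halts m \<longleftrightarrow> run q c \<langle>n, m\<rangle> = Some 0 \<and>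
      (\<forall>k<m. \<exists>v. run q c \<langle>n, k\<rangle> = Some (Suc v))" for m
  have "(if \<exists>m. halts m then Some (LEAST m. halts m) else None) = Some v"
    using Minimise.prems unfolding halts_def by (simp only: run.simps Let_def)
  then have "halts v" by (metis LeastI option.distinct(1) option.inject)
  define K where "K i = push 4 \<langle>prog_encode c, \<langle>n, i\<rangle>\<rangle> k" for i
  have loop: "reaches q (evaluating (prog_encode c) \<langle>n, i\<rangle> (K i)) (returning v k)"
    if "i + j = v" for i j
    using that
  proof (induction j arbitrary: i)
    case 0
    then have "run q c \<langle>n, i\<rangle> = Some 0" using \<open>halts v\<close> by (simp add: halts_def)
    then have "reaches q (evaluating (prog_encode c) \<langle>n, i\<rangle> (K i)) (returning 0 (K i))"
      by (rule Minimise.IH)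
    also have "reaches q (returning 0 (K i)) (returning v k)"
      using 0 unfolding K_def by (intro reaches_returning) (simp add: resume_def)
    finally show ?case .
  next
    case (Suc j)
    then have "i < v" by simp
    then obtain u where "run q c \<langle>n, i\<rangle> = Some (Suc u)"
      using \<open>halts v\<close> unfolding halts_def by blast
    then have "reaches q (evaluating (prog_encode c) \<langle>n, i\<rangle> (K i)) (returning (Suc u) (K i))"
      by (rule Minimise.IH)
    also have "reaches q (returning (Suc u) (K i)) (returning v k)"
      using Suc.IH[of "Suc i"] Suc.prems
      unfolding K_def by (intro reaches_returning) (simp add: resume_def)
    finally show ?case .
  qed
  show ?case
    using loop[of 0 v]
    unfolding K_def by (intro reaches_evaluating) (simp add: start_simps)
qed (rule reaches_evaluating, simp add: start_def)+

text \<open>The result is shifted by one, so that \<open>0\<close> stands for a computation that has not yet ended.\<close>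

definition value_within :: "baire \<Rightarrow> nat \<Rightarrow> nat \<Rightarrow> nat \<Rightarrow> nat" where
  "value_within q e n t =
    (let s = state_after q (evaluating e n 0) t in
     if nfst s = 0 then (if nsnd (nsnd s) = 0 then Suc (nfst (nsnd s)) else 0) else 0)"

lemma total_computable_value_within [computable_intros]:
  assumes "total_computable e" "total_computable a" "total_computable t"
  shows "total_computable (\<lambda>p n. value_within p (e p n) (a p n) (t p n))"
  unfolding value_within_def state_after_def Let_def by (intro computable_intros assms)

text \<open>A returned value with an empty stack is a fixed point of the transition function.\<close>

lemma value_within_stable:
  assumes "value_within q e n t \<noteq> 0" "t \<le> u"
  shows "value_within q e n u = value_within q e n t"
proof -
  define s where "s = state_after q (evaluating e n 0) t"
  have "step q s = s"
    using assms(1) by (simp add: value_within_def s_def[symmetric] step_def Let_def split: if_splits)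
  then have "state_after q s w = s" for w by (induction w) (simp_all add: state_after_def)
  then have "state_after q (evaluating e n 0) u = s"
    using state_after_add[of q "evaluating e n 0" t "u - t"] assms(2) by (simp add: s_def)
  then show ?thesis by (simp add: value_within_def s_def)
qed

lemma value_within_complete:
  assumes "run q c n = Some v"
  obtains t where "value_within q (prog_encode c) n t = Suc v"
proof -
  obtain t where t: "state_after q (evaluating (prog_encode c) n 0) t = returning v 0"
    using machine_complete[OF assms, of 0] unfolding reaches_def by blast
  show ?thesis by (rule that[of t]) (simp add: value_within_def t)
qed

lemma eventually_value_within:
  assumes "run q c n = Some v"
  shows "\<forall>\<^sub>F t in sequentially. value_within q (prog_encode c) n t = Suc v"
proof -
  obtain t where t: "value_within q (prog_encode c) n t = Suc v"
    using assms by (rule value_within_complete)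
  show ?thesis unfolding eventually_sequentially
    by (rule exI[of _ t]) (use value_within_stable[of q "prog_encode c" n t] t in auto)
qed

text \<open>By stability an early result agrees with the late one, which completeness identifies.\<close>

lemma value_within_sound:
  assumes "run q c n = Some v" "value_within q (prog_encode c) n t \<noteq> 0"
  shows "value_within q (prog_encode c) n t = Suc v"
proof -
  have "\<forall>\<^sub>F u in sequentially. value_within q (prog_encode c) n u = Suc v \<and> u \<ge> t"
    using eventually_value_within[OF assms(1)] eventually_ge_at_top by (rule eventually_conj)
  then obtain u where "value_within q (prog_encode c) n u = Suc v" "u \<ge> t"
    using eventually_happens'[OF sequentially_bot] by blast
  then show ?thesis using value_within_stable[OF assms(2), of u] by simp
qed

lemma eventually_step_eq:
  assumes "\<And>m. \<forall>\<^sub>F i in F. Q i m = q m"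
  shows "\<forall>\<^sub>F i in F. step (Q i) s = step q s"
  using assms[of "nfst (nsnd s)"]
  by eventually_elim (simp add: step_def start_def)

text \<open>
  Continuity in the oracle: a transition reads at most one oracle value, so finitely many
  transitions depend on finitely many values.
\<close>

lemma eventually_value_within_eq:
  assumes "\<And>m. \<forall>\<^sub>F i in F. Q i m = q m"
  shows "\<forall>\<^sub>F i in F. value_within (Q i) e n t = value_within q e n t"
proof -
  have "\<forall>\<^sub>F i in F. state_after (Q i) s t = state_after q s t" for s
  proof (induction t)
    case (Suc t)
    show ?case
      using Suc eventually_step_eq[of Q q F "state_after q s t", OF assms]
      by eventually_elim (simp add: state_after_def)
  qed (simp add: state_after_def)
  from this[of "evaluating e n 0"] show ?thesis
    by (rule eventually_mono) (simp add: value_within_def)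
qed

section \<open>Partial computable functionals\<close>

lemma computes_unique: "computes c p x \<Longrightarrow> computes c p y \<Longrightarrow> x = y"
  by (auto simp: computes_def fun_eq_iff)

text \<open>
  Search for a number of steps within which the machine ends, then read off the value. The
  minimisation looks for a zero, so its test is \<open>1\<close> as long as the machine is still running.
\<close>

lemma universal_program:
  "\<exists>u. \<forall>z x. computes (prog_decode (z 0)) (tail z) x \<longrightarrow> computes u z x"
proof -
  define W where "W z k t = value_within (tail z) (z 0) k t" for z k t
  have "total_computable
      (\<lambda>q i. value_within q (nfst i) (nfst (nsnd i)) (nsnd (nsnd i)))"
    by (intro computable_intros)
  from total_computable_compose[OF this total_computable_tail[OF total_computable_id]]
  have evaluate: "total_computable
      (\<lambda>z i. value_within (tail z) (nfst i) (nfst (nsnd i)) (nsnd (nsnd i)))" .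
  have "total_computable (\<lambda>z m. \<langle>z 0, m\<rangle>)" by (intro computable_intros)
  from total_computable_apply[OF evaluate this]
  have W: "total_computable (\<lambda>z m. W z (nfst m) (nsnd m))" by (simp add: W_def)
  have "total_computable (\<lambda>z m. if W z (nfst m) (nsnd m) = 0 then 1 else 0)"
    by (intro computable_intros W)
  then obtain c where c: "\<And>z m. run z c m = Some (if W z (nfst m) (nsnd m) = 0 then 1 else 0)"
    unfolding total_computable_def computes_def by blast
  have "total_computable (\<lambda>z m. W z (nfst m) (nsnd m) - 1)"
    by (intro computable_intros W)
  then obtain d where d: "\<And>z m. run z d m = Some (W z (nfst m) (nsnd m) - 1)"
    unfolding total_computable_def computes_def by blast
  have "run z (Compose d (Pairing (Pairing Left Right) (Minimise c))) k = Some v"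
    if v: "run (tail z) (prog_decode (z 0)) k = Some v" for z k v
  proof -
    obtain t where "value_within (tail z) (prog_encode (prog_decode (z 0))) k t = Suc v"
      using v by (rule value_within_complete)
    then have ex: "\<exists>t. W z k t \<noteq> 0" unfolding W_def by (intro exI[of _ t]) simp
    define halts where "halts m \<longleftrightarrow> run z c \<langle>k, m\<rangle> = Some 0 \<and>
        (\<forall>j<m. \<exists>v. run z c \<langle>k, j\<rangle> = Some (Suc v))" for m
    have halts_iff: "halts m \<longleftrightarrow> W z k m \<noteq> 0 \<and> (\<forall>j<m. W z k j = 0)" for m
      by (auto simp: halts_def c)
    have "halts (LEAST t. W z k t \<noteq> 0)"
      using LeastI_ex[OF ex] not_less_Least unfolding halts_iff by blast
    moreover have "run z (Minimise c) k =
        (if \<exists>m. halts m then Some (LEAST m. halts m) else None)"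
      by (simp only: run.simps Let_def halts_def)
    ultimately have "run z (Minimise c) k = Some (LEAST m. halts m)" "halts (LEAST m. halts m)"
      using LeastI[of halts] by auto
    moreover have "W z k t = Suc v" if "halts t" for t
      using that value_within_sound[OF v, of t]
      by (simp add: halts_iff W_def)
    ultimately show ?thesis by (simp add: d)
  qed
  then show ?thesis unfolding computes_def
    by (intro exI[of _ "Compose d (Pairing (Pairing Left Right) (Minimise c))"]) simp
qed

lemma postcompose_total:
  assumes "total_computable t"
  shows "\<exists>d. \<forall>p x. computes a p x \<longrightarrow> computes d p (t x)"
proof -
  obtain c where "\<forall>x. computes c x (t x)" using assms unfolding total_computable_def by blast
  with compose_programs[of a c] show ?thesis unfolding computes_def by metis
qed

lemma pair_programs:
  "\<exists>d. \<forall>p x y. computes a p x \<longrightarrow> computes b p y \<longrightarrow> computes d p (pair x y)"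
proof -
  have "total_computable (\<lambda>p n. if nsnd (nsnd n) mod 2 = 0 then nfst n else nfst (nsnd n))"
    by (intro computable_intros)
  then obtain sel where sel: "\<And>p n. run p sel n =
      Some (if nsnd (nsnd n) mod 2 = 0 then nfst n else nfst (nsnd n))"
    unfolding total_computable_def computes_def by blast
  have "total_computable (\<lambda>p n. n div 2)" by (intro computable_intros)
  then obtain half where half: "\<And>p n. run p half n = Some (n div 2)"
    unfolding total_computable_def computes_def by blast
  show ?thesis
    by (rule exI[of _ "Compose sel (Pairing (Compose a half)
          (Pairing (Compose b half) (Pairing Left Right)))"])
       (simp add: computes_def sel half pair_def even_iff_mod_2_eq_zero)
qed

section \<open>Problems that absorb partiality\<close>

text \<open>
  The programs \<open>a\<close> and \<open>b\<close> play the roles of the two partial functionals in an instance of the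
  tot-jump, preparing the instance and postprocessing the answer. Crucially \<open>h\<close> and \<open>K\<close> are total,
  and \<open>K\<close> depends neither on \<open>a\<close> and \<open>b\<close> nor on the input \<open>p\<close>.
\<close>

definition absorbs_partiality :: "problem \<Rightarrow> bool" where
  "absorbs_partiality f \<longleftrightarrow> (\<exists>K. total_computable K \<and>
    (\<forall>a b. \<exists>h. total_computable h \<and>
      (\<forall>p x. computes a p x \<longrightarrow> x \<in> pdom f \<longrightarrow> (\<forall>q\<in>f x. \<exists>y. computes b (pair p q) y) \<longrightarrow>
        h p \<in> pdom f \<and> (\<forall>r\<in>f (h p). \<exists>q\<in>f x. computes b (pair p q) (K r)))))"

text \<open>
  Absorption is applied to two fixed programs: they take the indices from the instance of the
  tot-jump and pass them to the universal program.
\<close>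

lemma tot_jump_le_totalization:
  assumes "absorbs_partiality f"
  shows "tot_jump f \<le>\<^sub>W totalization f"
proof -
  obtain u where u: "\<And>z x. computes (prog_decode (z 0)) (tail z) x \<Longrightarrow> computes u z x"
    using universal_program by blast
  have "total_computable (\<lambda>z. prepend (z 0) (tail (tail z)))"
    by (intro computable_intros)
  then obtain a where a: "\<And>z n. run z a n = run (prepend (z 0) (tail (tail z))) u n"
    using precompose_total[of _ u] by blast
  have "total_computable (\<lambda>z. prepend (tail (pfst z) 0) (pair (tail (tail (pfst z))) (psnd z)))"
    by (intro computable_intros 
        total_computable_apply[OF total_computable_tail[OF total_computable_pfst[OF total_computable_id]]])
  then obtain b where b: "\<And>z n. run z b n =
      run (prepend (tail (pfst z) 0) (pair (tail (tail (pfst z))) (psnd z))) u n"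
    using precompose_total[of _ u] by blast
  obtain K h where K: "total_computable K" and h: "total_computable h"
    and absorb: "\<And>z x. computes a z x \<Longrightarrow> x \<in> pdom f \<Longrightarrow>
      (\<forall>q\<in>f x. \<exists>y. computes b (pair z q) y) \<Longrightarrow>
      h z \<in> pdom f \<and> (\<forall>r\<in>f (h z). \<exists>q\<in>f x. computes b (pair z q) (K r))"
    using assms unfolding absorbs_partiality_def by blast
  have a_computes: "computes a z x" if "Phi (z 0) (tail (tail z)) = Some x" for z x
    using u[of "prepend (z 0) (tail (tail z))" x] that by (simp add: Phi_iff computes_def a)
  have b_computes: "computes b (pair z q) y"
    if "Phi (tail z 0) (pair (tail (tail z)) q) = Some y" for z q y
    using u[of "prepend (tail z 0) (pair (tail (tail z)) q)" y] that
    by (simp add: Phi_iff computes_def b)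
  have solves: "K r \<in> tot_jump f z" if r: "r \<in> totalization f (h z)" for z r
  proof (cases "\<exists>x. Phi (z 0) (tail (tail z)) = Some x \<and> x \<in> pdom f \<and>
      (\<forall>q\<in>f x. Phi (tail z 0) (pair (tail (tail z)) q) \<noteq> None)")
    case True
    then obtain x where x: "Phi (z 0) (tail (tail z)) = Some x" "x \<in> pdom f"
      and defined: "\<And>q. q \<in> f x \<Longrightarrow> \<exists>y. Phi (tail z 0) (pair (tail (tail z)) q) = Some y"
      by blast
    have "h z \<in> pdom f \<and> (\<forall>r\<in>f (h z). \<exists>q\<in>f x. computes b (pair z q) (K r))"
      using a_computes[OF x(1)] x(2) by (rule absorb) (use defined b_computes in blast)
    with r obtain q where q: "q \<in> f x" "computes b (pair z q) (K r)"
      by (auto simp: totalization_def)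
    obtain y where "Phi (tail z 0) (pair (tail (tail z)) q) = Some y"
      using defined q(1) by blast
    with q b_computes computes_unique
    have "Phi (tail z 0) (pair (tail (tail z)) q) = Some (K r)" by blast
    with True q(1) x(1) show ?thesis by (auto simp: tot_jump_def tot_jump_at_def)
  next
    case False
    then show ?thesis unfolding tot_jump_def tot_jump_at_def by (simp only: if_False UNIV_I)
  qed
  have dom: "h z \<in> pdom (totalization f)" for z
    by (auto simp: pdom_def totalization_def)
  have "total_computable (\<lambda>z. K (psnd z))"
    by (rule total_computable_compose[OF K]) (intro computable_intros)
  then show ?thesis unfolding weihrauch_le_def
    by (intro exI[of _ "\<lambda>z. Some (h z)"] exI[of _ "\<lambda>z. Some (K (psnd z))"] conjI
        total_computable_functional h) (auto simp: dom solves)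
qed

lemma totalization_le_tot_jump: "totalization f \<le>\<^sub>W tot_jump f"
proof -
  obtain e where e: "\<And>p. Phi e p = Some p"
  proof -
    from total_computable_id show thesis using that
      unfolding total_computable_def Phi_encode_iff[symmetric] by blast
  qed
  obtain i where i: "\<And>p. Phi i p = Some (psnd p)"
  proof -
    have "total_computable (\<lambda>p. psnd p)" by (intro computable_intros)
    then show thesis using that unfolding total_computable_def Phi_encode_iff[symmetric] by blast
  qed
  have eq: "tot_jump f (prepend e (prepend i p)) = totalization f p" for p
    by (auto simp: tot_jump_def tot_jump_at_def totalization_def e i)
  have dom: "totalization f p \<noteq> {}" for p by (auto simp: totalization_def pdom_def)
  have "total_computable (\<lambda>p. prepend e (prepend i p))" "total_computable (\<lambda>p. psnd p)"
    by (intro computable_intros)+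
  then show ?thesis unfolding weihrauch_le_def
    by (intro exI[of _ "\<lambda>p. Some (prepend e (prepend i p))"] exI[of _ "\<lambda>z. Some (psnd z)"] conjI
        total_computable_functional) (auto simp: eq dom pdom_def)
qed

section \<open>Limits\<close>

text \<open>As \<open>\<nat>\<close> is discrete, each coordinate of a convergent sequence is eventually constant.\<close>

lemma lim_problem_iff:
  "y \<in> lim_problem x \<longleftrightarrow> (\<forall>j. \<forall>\<^sub>F s in sequentially. x \<langle>s, j\<rangle> = y j)"
proof -
  have "seq_of x \<longlonglongrightarrow> y \<longleftrightarrow> (\<forall>j. (\<lambda>s. seq_of x s j) \<longlonglongrightarrow> y j)"
    using limitin_componentwise[of "\<lambda>_. euclidean" UNIV "seq_of x" y sequentially]
    by (simp add: euclidean_product_topology)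
  then show ?thesis by (simp add: lim_problem_def seq_of_def tendsto_discrete)
qed

lemma lim_problem_unique:
  assumes "y \<in> lim_problem x" "z \<in> lim_problem x"
  shows "y = z"
proof
  fix j
  have "\<forall>\<^sub>F s in sequentially. x \<langle>s, j\<rangle> = y j \<and> x \<langle>s, j\<rangle> = z j"
    using assms unfolding lim_problem_iff by (intro eventually_conj) auto
  then show "y j = z j" using eventually_happens'[OF sequentially_bot] by fastforce
qed

text \<open>
  A total guess at stage \<open>s\<close> for the limit of the sequence computed by \<open>a\<close>: the recursion scans the
  terms \<open>t < s\<close> upwards and keeps the last value found within \<open>s\<close> steps, starting from the default
  \<open>0\<close>. Skipping unfinished terms is harmless, since the value at \<open>j\<close> is constant from some
  term \<open>T\<close> on and every finished term after \<open>T\<close> shows it.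
\<close>

definition latest_value :: "prog \<Rightarrow> baire \<Rightarrow> nat \<Rightarrow> baire" where
  "latest_value a p s j =
    rec_nat 0 (\<lambda>t r. if value_within p (prog_encode a) \<langle>t, j\<rangle> s = 0 then r
                     else value_within p (prog_encode a) \<langle>t, j\<rangle> s - 1) s"

lemma latest_value_eventually:
  assumes "computes a p x" "q \<in> lim_problem x"
  shows "\<forall>\<^sub>F s in sequentially. latest_value a p s j = q j"
proof -
  obtain T where T: "\<And>t. t \<ge> T \<Longrightarrow> x \<langle>t, j\<rangle> = q j"
    using assms(2) unfolding lim_problem_iff eventually_sequentially by blast
  have run: "run p a \<langle>t, j\<rangle> = Some (x \<langle>t, j\<rangle>)" for t using assms(1) by (simp add: computes_def)
  have "\<forall>\<^sub>F s in sequentially. value_within p (prog_encode a) \<langle>T, j\<rangle> s = Suc (x \<langle>T, j\<rangle>) \<and> s \<ge> Suc T"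
    using eventually_value_within[OF run] eventually_ge_at_top by (rule eventually_conj)
  then show ?thesis
  proof (rule eventually_mono)
    fix s assume s: "value_within p (prog_encode a) \<langle>T, j\<rangle> s = Suc (x \<langle>T, j\<rangle>) \<and> s \<ge> Suc T"
    have "rec_nat 0 (\<lambda>t r. if value_within p (prog_encode a) \<langle>t, j\<rangle> s = 0 then r
        else value_within p (prog_encode a) \<langle>t, j\<rangle> s - 1) m = q j" if "Suc T \<le> m" for m
      using that
    proof (induction m rule: dec_induct)
      case base
      then show ?case using s T[of T] by simp
    next
      case (step m)
      then show ?case using T[of m] value_within_sound[OF run[of m], of s] by auto
    qed
    with s show "latest_value a p s j = q j" by (simp add: latest_value_def)
  qed
qed

lemma total_computable_latest_value [computable_intros]:
  assumes "total_computable s" "total_computable j"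
  shows "total_computable (\<lambda>p n. latest_value a p (s p n) (j p n))"
  unfolding latest_value_def
  by (intro computable_intros assms total_computable_apply[OF assms(1)]
      total_computable_apply[OF assms(2)])

text \<open>
  Each entry of the postprocessed answer needs finitely many steps and finitely many entries of the
  limit, so from some stage on it is found and stays. The limit of the stages is that answer itself,
  so \<open>K\<close> is the identity.
\<close>

lemma lim_absorbs_partiality: "absorbs_partiality lim_problem"
proof -
  have "\<exists>h. total_computable h \<and>
      (\<forall>p x. computes a p x \<longrightarrow> x \<in> pdom lim_problem \<longrightarrow>
        (\<forall>q\<in>lim_problem x. \<exists>y. computes b (pair p q) y) \<longrightarrow>
        h p \<in> pdom lim_problem \<and>
        (\<forall>r\<in>lim_problem (h p). \<exists>q\<in>lim_problem x. computes b (pair p q) r))" for a b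
  proof -
    define h where "h p m = value_within (pair p (latest_value a p (nfst m)))
      (prog_encode b) (nsnd m) (nfst m) - 1" for p m
    \<comment> \<open>The stage is the parameter of the oracle substitution.\<close>
    have evaluate: "total_computable (\<lambda>q i. value_within q (prog_encode b) (nfst i) (nsnd i) - 1)"
      by (intro computable_intros)
    have approximation: "total_computable (\<lambda>p i. pair p (latest_value a p (nfst i)) (nsnd i))"
      unfolding pair_def even_iff_mod_2_eq_zero by (intro computable_intros)
    have stage: "total_computable (\<lambda>p m. nfst m)" "total_computable (\<lambda>p m. \<langle>nsnd m, nfst m\<rangle>)"
      by (intro computable_intros)+
    have h: "total_computable h"
      using total_computable_oracle_param[OF evaluate approximation stage] by (simp add: h_def[abs_def])
    have lim_h: "y \<in> lim_problem (h p)"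
      if x: "computes a p x" and q: "q \<in> lim_problem x" and y: "computes b (pair p q) y" for p x q y
      unfolding lim_problem_iff
    proof
      fix k
      have "run (pair p q) b k = Some (y k)" using y by (simp add: computes_def)
      then obtain t where t: "value_within (pair p q) (prog_encode b) k t = Suc (y k)"
        by (rule value_within_complete)
      have "\<forall>\<^sub>F s in sequentially. pair p (latest_value a p s) m = pair p q m" for m
        using latest_value_eventually[OF x q, of "m div 2"]
        by eventually_elim (simp add: pair_def)
      then have "\<forall>\<^sub>F s in sequentially.
          value_within (pair p (latest_value a p s)) (prog_encode b) k t =
          value_within (pair p q) (prog_encode b) k t"
        by (rule eventually_value_within_eq)
      then show "\<forall>\<^sub>F s in sequentially. h p \<langle>s, k\<rangle> = y k"
        using eventually_ge_at_top[of t]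
      proof eventually_elim
        case (elim s)
        then show ?case
          using t value_within_stable[of "pair p (latest_value a p s)" "prog_encode b" k t s]
          by (simp add: h_def)
      qed
    qed
    show ?thesis
    proof (intro exI[of _ h] conjI h allI impI)
      fix p x
      assume x: "computes a p x" "x \<in> pdom lim_problem"
        and defined: "\<forall>q\<in>lim_problem x. \<exists>y. computes b (pair p q) y"
      then obtain q where q: "q \<in> lim_problem x" by (auto simp: pdom_def)
      with defined obtain y where y: "computes b (pair p q) y" by blast
      have y_h: "y \<in> lim_problem (h p)" by (rule lim_h[OF x(1) q y])
      then show "h p \<in> pdom lim_problem" by (auto simp: pdom_def)
      have "r = y" if "r \<in> lim_problem (h p)" for r
        using lim_problem_unique[OF that y_h] .
      then show "\<forall>r\<in>lim_problem (h p). \<exists>q\<in>lim_problem x. computes b (pair p q) r"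
        using q y by blast
    qed
  qed
  with total_computable_id show ?thesis unfolding absorbs_partiality_def by blast
qed

section \<open>Compositional products\<close>

lemma comp_product_pair:
  "(f \<star> g) (pair p x) =
    (if x \<in> pdom g \<and> (\<forall>w\<in>g x. \<exists>u. Gamma p w = Some u \<and> u \<in> pdom f)
     then {pair y w |y w. w \<in> g x \<and> (\<exists>u. Gamma p w = Some u \<and> y \<in> f u)} else {})"
  by (simp add: comp_product_def)

text \<open>
  The answer of the outer problem carries the final result, so \<open>K\<close> first projects to it and then
  applies the map belonging to \<open>f\<close>. The answer \<open>w\<close> of the original inner problem is recovered by
  taking the second projection as the postprocessing for \<open>g\<close>.
\<close>

lemma comp_product_absorbs_partiality:
  assumes "absorbs_partiality f" "absorbs_partiality g"
  shows "absorbs_partiality (f \<star> g)"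
proof -
  obtain Kf where Kf: "total_computable Kf" and absorb_f: "\<And>a b. \<exists>h. total_computable h \<and>
      (\<forall>p x. computes a p x \<longrightarrow> x \<in> pdom f \<longrightarrow> (\<forall>q\<in>f x. \<exists>y. computes b (pair p q) y) \<longrightarrow>
        h p \<in> pdom f \<and> (\<forall>r\<in>f (h p). \<exists>q\<in>f x. computes b (pair p q) (Kf r)))"
    using assms(1) unfolding absorbs_partiality_def by blast
  obtain Kg where Kg: "total_computable Kg" and absorb_g: "\<And>a b. \<exists>h. total_computable h \<and>
      (\<forall>p x. computes a p x \<longrightarrow> x \<in> pdom g \<longrightarrow> (\<forall>q\<in>g x. \<exists>y. computes b (pair p q) y) \<longrightarrow>
        h p \<in> pdom g \<and> (\<forall>r\<in>g (h p). \<exists>q\<in>g x. computes b (pair p q) (Kg r)))"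
    using assms(2) unfolding absorbs_partiality_def by blast
  have "\<exists>h. total_computable h \<and>
      (\<forall>p z. computes a p z \<longrightarrow> z \<in> pdom (f \<star> g) \<longrightarrow>
        (\<forall>q\<in>(f \<star> g) z. \<exists>v. computes b (pair p q) v) \<longrightarrow>
        h p \<in> pdom (f \<star> g) \<and>
        (\<forall>r\<in>(f \<star> g) (h p). \<exists>q\<in>(f \<star> g) z. computes b (pair p q) (Kf (pfst r))))" for a b
  proof -
    \<comment> \<open>The inner problem: prepare the second component of the instance, keep the answer.\<close>
    obtain ag where ag: "\<And>p z. computes a p z \<Longrightarrow> computes ag p (psnd z)"
      using postcompose_total[of psnd a] total_computable_psnd[OF total_computable_id]
      by auto
    have "total_computable psnd"
      using total_computable_psnd[OF total_computable_id] by simp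
    then obtain bg where bg: "\<And>p. computes bg p (psnd p)"
      unfolding total_computable_def by blast
    obtain hg where hg: "total_computable hg" and absorb_hg: "\<And>p x. computes ag p x \<Longrightarrow>
        x \<in> pdom g \<Longrightarrow> (\<forall>q\<in>g x. \<exists>y. computes bg (pair p q) y) \<Longrightarrow>
        hg p \<in> pdom g \<and> (\<forall>r\<in>g (hg p). \<exists>q\<in>g x. computes bg (pair p q) (Kg r))"
      using absorb_g[of ag bg] by blast
    have inner: "hg p \<in> pdom g \<and> (\<forall>r\<in>g (hg p). Kg r \<in> g (psnd z))"
      if "computes a p z" "psnd z \<in> pdom g" for p z
    proof -
      have "q = Kg r" if "computes bg (pair p q) (Kg r)" for q r
        using computes_unique[OF that bg] by simp
      then show ?thesis
        using absorb_hg[OF ag[OF that(1)] that(2)] bg by fastforce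
    qed

    \<comment> \<open>The outer problem, for inputs \<open>pair p r\<close> with an answer \<open>r\<close> of the totalized inner instance:
      preparation evaluates the original \<open>Gamma\<close> functional at the recovered answer \<open>Kg r\<close> \<dots>\<close>
    obtain a' where a': "\<And>r n. run r a' n = run (pfst r) a n"
      using precompose_total[of pfst a] total_computable_pfst[OF total_computable_id] by auto
    obtain idp where idp: "\<And>p. computes idp p p"
      using total_computable_id unfolding total_computable_def by blast
    obtain c where c: "\<And>p x y. computes a' p x \<Longrightarrow> computes idp p y \<Longrightarrow> computes c p (pair x y)"
      using pair_programs[of a' idp] by blast
    define arg where "arg z = prepend (pfst (pfst z) 0)
      (pair (tail (pfst (pfst z))) (Kg (psnd (psnd z))))" for z
    have "total_computable arg"
      unfolding arg_def[abs_def]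
      by (intro computable_intros total_computable_compose[OF Kg] total_computable_id
          total_computable_apply[OF total_computable_pfst[OF total_computable_pfst[OF total_computable_id]]])
    then obtain d where d: "\<And>p x. computes c p x \<Longrightarrow> computes d p (arg x)"
      using postcompose_total[of arg c] by blast
    obtain u where u: "\<And>z x. computes (prog_decode (z 0)) (tail z) x \<Longrightarrow> computes u z x"
      using universal_program by blast
    obtain af where af: "\<And>p x n. computes d p x \<Longrightarrow> run p af n = run x u n"
      using compose_programs[of d u] by blast
    have af_computes: "computes af (pair p r) v"
      if z: "computes a p z" and v: "Gamma (pfst z) (Kg r) = Some v" for p r z v
    proof -
      have "computes a' (pair p r) z" using z by (simp add: computes_def a')
      then have dz: "computes d (pair p r) (arg (pair z (pair p r)))" using c idp d by blast
      have "computes u (arg (pair z (pair p r))) v"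
        by (rule u) (use v in \<open>simp add: arg_def Gamma_def Phi_iff\<close>)
      then show ?thesis by (simp add: computes_def af[OF dz])
    qed

    \<comment> \<open>\<dots> and postprocessing runs \<open>b\<close> on the reassembled answer to the original instance.\<close>
    have "total_computable (\<lambda>z. pair (pfst (pfst z)) (pair (psnd z) (Kg (psnd (pfst z)))))"
      by (intro computable_intros total_computable_compose[OF Kg] total_computable_id)
    then obtain bf where bf: "\<And>z n. run z bf n =
        run (pair (pfst (pfst z)) (pair (psnd z) (Kg (psnd (pfst z))))) b n"
      using precompose_total[of _ b] by blast
    have bf_computes: "computes bf (pair (pair p r) y) v \<longleftrightarrow> computes b (pair p (pair y (Kg r))) v"
      for p r y v
      by (simp add: computes_def bf)
    obtain hf where hf: "total_computable hf" and absorb_hf: "\<And>p x. computes af p x \<Longrightarrow>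
        x \<in> pdom f \<Longrightarrow> (\<forall>q\<in>f x. \<exists>y. computes bf (pair p q) y) \<Longrightarrow>
        hf p \<in> pdom f \<and> (\<forall>r\<in>f (hf p). \<exists>q\<in>f x. computes bf (pair p q) (Kf r))"
      using absorb_f[of af bf] by blast
    obtain e where e: "\<And>p. computes e p (hf p)"
      using hf unfolding total_computable_def by blast
    have Gamma_e: "Gamma (prepend (prog_encode e) p) r = Some (hf (pair p r))" for p r
      using e by (simp add: Gamma_def Phi_encode_iff)

    \<comment> \<open>The first argument of the product is the program of \<open>hf\<close> with parameter \<open>p\<close>.\<close>
    define h where "h p = pair (prepend (prog_encode e) p) (hg p)" for p
    have "total_computable h"
      unfolding h_def[abs_def] by (intro computable_intros hg total_computable_id)
    moreover have "h p \<in> pdom (f \<star> g) \<and>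
        (\<forall>r\<in>(f \<star> g) (h p). \<exists>q\<in>(f \<star> g) z. computes b (pair p q) (Kf (pfst r)))"
      if z: "computes a p z" "z \<in> pdom (f \<star> g)"
        and defined: "\<forall>q\<in>(f \<star> g) z. \<exists>v. computes b (pair p q) v" for p z
    proof -
      have dom_g: "psnd z \<in> pdom g"
        and dom_f: "\<And>w. w \<in> g (psnd z) \<Longrightarrow> \<exists>v. Gamma (pfst z) w = Some v \<and> v \<in> pdom f"
        using z(2) by (auto simp: pdom_def comp_product_def Let_def split: if_splits)
      have sol: "pair y w \<in> (f \<star> g) z"
        if "w \<in> g (psnd z)" "Gamma (pfst z) w = Some v" "y \<in> f v" for y w v
        using that dom_g dom_f by (auto simp: comp_product_def Let_def)
      have hg_dom: "hg p \<in> pdom g" and Kg_sol: "\<And>r. r \<in> g (hg p) \<Longrightarrow> Kg r \<in> g (psnd z)"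
        using inner[OF z(1) dom_g] by auto
      have outer: "hf (pair p r) \<in> pdom f \<and>
          (\<forall>y\<in>f (hf (pair p r)). \<exists>q\<in>(f \<star> g) z. computes b (pair p q) (Kf y))"
        if r: "r \<in> g (hg p)" for r
      proof -
        obtain v where v: "Gamma (pfst z) (Kg r) = Some v" "v \<in> pdom f"
          using dom_f[OF Kg_sol[OF r]] by blast
        have sol_r: "pair y (Kg r) \<in> (f \<star> g) z" if "y \<in> f v" for y
          using sol[OF Kg_sol[OF r] v(1) that] .
        have "hf (pair p r) \<in> pdom f \<and>
            (\<forall>y\<in>f (hf (pair p r)). \<exists>q\<in>f v. computes bf (pair (pair p r) q) (Kf y))"
          using af_computes[OF z(1) v(1)] v(2)
          by (rule absorb_hf) (use sol_r defined bf_computes in blast)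
        then show ?thesis using sol_r bf_computes by blast
      qed
      have product: "(f \<star> g) (h p) = {pair y r |y r. r \<in> g (hg p) \<and> y \<in> f (hf (pair p r))}"
        using hg_dom outer by (auto simp: h_def comp_product_pair Gamma_e)
      obtain r where r: "r \<in> g (hg p)" using hg_dom by (auto simp: pdom_def)
      then obtain y where "y \<in> f (hf (pair p r))" using outer by (auto simp: pdom_def)
      with r product have "h p \<in> pdom (f \<star> g)" by (auto simp: pdom_def)
      then show ?thesis using outer by (auto simp: product)
    qed
    ultimately show ?thesis by blast
  qed
  moreover have "total_computable (\<lambda>r. Kf (pfst r))"
    by (rule total_computable_compose[OF Kf]) (intro computable_intros)
  ultimately show ?thesis unfolding absorbs_partiality_def by blast
qed

lemma lim_power_absorbs_partiality:
  "absorbs_partiality (comp_power lim_problem (Suc n))"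
  by (induction n) (simp_all add: lim_absorbs_partiality comp_product_absorbs_partiality)

theorem theorem4p17:
  fixes n :: nat
  assumes "n \<ge> 1"
  shows "tot_jump (comp_power lim_problem n) \<equiv>\<^sub>W totalization (comp_power lim_problem n)"
proof -
  obtain m where "n = Suc m" using assms by (cases n) auto
  then show ?thesis
    unfolding weihrauch_equiv_def
    using tot_jump_le_totalization[OF lim_power_absorbs_partiality[of m]] totalization_le_tot_jump
    by simp
qed

end
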